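(* Let $N$ be a set in $\mathbb{R}^d$ with $d\geq 2$ such that for all $x\in N$ $$\liminf_{r\to 0}\frac{\int_r^{1}\beta_N^2(x,t)\,\frac{dt}{t}}{-\log r}\leq \beta_0^2 .$$ Then there is a universal constant $c>0$ such that $\dim_H(N)\leq 1+c\,\beta_0^2$.
   Context: $\dim_H$ is the Hausdorff dimension and $\beta_0$ is a real number. For a set $N\subset\mathbb{R}^d$, $x\in N$ and $r>0$, $$\beta_N(x,r):=\inf_L\ \sup_{z\in N\cap B(x,r)}\frac{\operatorname{dist}(z,L)}{r},$$ where the infimum is over all lines $L$ in $\mathbb{R}^d$ and $B(x,r)$ is the ball of center $x$ and radius $r$.
   Formalization: The constant c is universal only for fixed d: it may depend on the dimension d, but not on N or β_0. A constant independent of d is impossible, since N = R^d has β_N = 1 everywhere and Hausdorff dimension d, which forces c ≥ d − 1. *)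

theory Defs
  imports "HOL-Analysis.Analysis"
begin

text \<open>
  The cost \<open>(diam U)\<^sup>s\<close> of a bounded covering set, with the usual conventions
  \<open>0\<^sup>0 = 1\<close> for a nonempty \<open>U\<close> and cost \<open>0\<close> for the empty set, for every \<open>s\<close>
  (in the library, \<open>0 powr 0 = 0\<close>).
\<close>

definition hausdorff_gauge :: "real \<Rightarrow> 'a::metric_space set \<Rightarrow> ennreal" where
  "hausdorff_gauge s U =
     (if U = {} then 0 else if s = 0 then 1 else ennreal (diameter U powr s))"

text \<open>
  Boundedness is required separately since \<^const>\<open>diameter\<close> is real-valued and carries no
  information on unbounded sets. Finite covers are included by padding with empty sets.
\<close>

definition hausdorff_premeasure :: "real \<Rightarrow> real \<Rightarrow> 'a::metric_space set \<Rightarrow> ennreal" where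
  "hausdorff_premeasure s \<delta> E =
     (INF U \<in> {U :: nat \<Rightarrow> 'a set. E \<subseteq> (\<Union>i. U i) \<and> (\<forall>i. bounded (U i) \<and> diameter (U i) \<le> \<delta>)}.
        (\<Sum>i. hausdorff_gauge s (U i)))"

definition hausdorff_measure :: "real \<Rightarrow> 'a::metric_space set \<Rightarrow> ennreal" where
  "hausdorff_measure s E = (SUP \<delta> \<in> {0<..}. hausdorff_premeasure s \<delta> E)"

definition hausdorff_dim :: "'a::metric_space set \<Rightarrow> ennreal" where
  "hausdorff_dim E = (INF s \<in> {s. 0 \<le> s \<and> hausdorff_measure s E = 0}. ennreal s)"

definition is_line :: "'a::euclidean_space set \<Rightarrow> bool" where
  "is_line L \<longleftrightarrow> affine L \<and> aff_dim L = 1"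

text \<open>
  The number \<open>\<beta>\<^sub>N(x,r)\<close>, meaningful for \<open>x \<in> N\<close> and \<open>r > 0\<close>: the supremum is then over a
  nonempty set that is bounded above, and the infimum over one that is bounded below by \<open>0\<close>
  (nonempty as soon as the space has positive dimension).
  As \<open>r \<cdot> \<beta>\<^sub>N(x,r)\<close> is monotone in \<open>r\<close>, using closed balls instead of open ones would
  change \<open>\<beta>\<^sub>N(x,r)\<close> for at most countably many \<open>r\<close> only, hence no integral against \<open>dr\<close>.
\<close>

definition beta_number :: "'a::euclidean_space set \<Rightarrow> 'a \<Rightarrow> real \<Rightarrow> real" where
  "beta_number N x r = (INF L \<in> {L. is_line L}. SUP z \<in> N \<inter> ball x r. infdist z L / r)"

end

theory Submission imports Defs
begin

text \<open>
  A ball of radius \<open>r\<close> in which \<open>N\<close> stays within \<open>h r\<close> of a line is covered, on \<open>N\<close>, by two balls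
  of radius \<open>r/2 (1 + 2 h\<^sup>2)\<close>; if \<open>h\<close> is not small, a bounded number of balls of radius \<open>r/2\<close> does.
  Either way one subdivision multiplies the sum of the radii by at most \<open>exp (O(h\<^sup>2))\<close>, with no
  further constant. Iterating down to scale \<open>s\<close>, the points at which the integral of
  \<open>\<beta>\<^sup>2/t\<close> over \<open>[2s, 1]\<close> is at most \<open>M\<close> lie in \<open>O(exp (D M) / s)\<close> balls of radius \<open>s\<close>.
  With \<open>s = 2\<^sup>-\<^sup>k\<close> and \<open>M\<close> slightly above \<open>\<beta>\<^sub>0\<^sup>2 ln (1/s)\<close>, every point of \<open>N\<close> lies in such a
  set for infinitely many \<open>k\<close>, and a Borel-Cantelli argument gives a null Hausdorff measure in every
  dimension above \<open>1 + D \<beta>\<^sub>0\<^sup>2\<close>. The small \<open>\<epsilon>\<close> added to \<open>\<beta>\<^sup>2\<close> throughout absorbs the fact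
  that the infimum over lines need not be attained.
\<close>

section \<open>Lines\<close>

lemma is_line_direction:
  fixes L :: "'a::euclidean_space set"
  assumes "is_line L"
  obtains q u where "norm u = 1" "\<And>y. y \<in> L \<Longrightarrow> \<exists>t. y = q + t *\<^sub>R u"
proof -
  from assms have L: "affine L" "aff_dim L = 1" by (auto simp: is_line_def)
  obtain B where B: "affine hull B = affine hull L" "int (card B) = aff_dim L + 1"
    using aff_dim_basis_exists[of L] by blast
  have "card B = 2" using B L by simp
  then obtain a b where ab: "B = {a, b}" "a \<noteq> b" by (meson card_2_iff)
  have Leq: "L = affine hull {a, b}" using B(1) ab(1) L(1) by (metis affine_hull_eq)
  show thesis
  proof
    show "norm ((1 / norm (b - a)) *\<^sub>R (b - a)) = 1" using ab by simp
    fix y assume "y \<in> L"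
    then obtain t where t: "y = a + t *\<^sub>R (b - a)" by (auto simp: Leq affine_hull_2_alt)
    then have "y = a + (t * norm (b - a)) *\<^sub>R ((1 / norm (b - a)) *\<^sub>R (b - a))" using ab by simp
    then show "\<exists>t. y = a + t *\<^sub>R ((1 / norm (b - a)) *\<^sub>R (b - a))" by blast
  qed
qed

lemma ex_is_line: "\<exists>L :: 'a::euclidean_space set. is_line L"
proof -
  obtain b :: 'a where b: "b \<in> Basis" using nonempty_Basis by blast
  have "is_line (affine hull {0, b})"
    unfolding is_line_def using nonzero_Basis[OF b]
    by (auto simp: aff_dim_2)
  then show ?thesis by blast
qed

section \<open>The numbers beta\<close>

text \<open>A real \<open>SUP\<close> or \<open>INF\<close> can be compared with its members only
  under boundedness; here it holds because \<open>infdist\<close> is 1-Lipschitz.\<close>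

lemma bdd_above_infdist_ball:
  fixes x :: "'a::euclidean_space"
  assumes "r > 0" "is_line L"
  shows "bdd_above ((\<lambda>z. infdist z L / r) ` (N \<inter> ball x r))"
proof -
  have "infdist z L / r \<le> (infdist x L + r) / r" if "z \<in> ball x r" for z
    using infdist_triangle[of z L x] that assms
    by (intro divide_right_mono) (auto simp: dist_commute)
  then show ?thesis by (intro bdd_aboveI2) auto
qed

lemma SUP_infdist_nonneg:
  fixes x :: "'a::euclidean_space"
  assumes "r > 0" "x \<in> N" "is_line L"
  shows "0 \<le> (SUP z \<in> N \<inter> ball x r. infdist z L / r)"
proof -
  have "0 \<le> infdist x L / r" using assms by (simp add: infdist_nonneg)
  also have "\<dots> \<le> (SUP z \<in> N \<inter> ball x r. infdist z L / r)"
    using assms by (intro cSUP_upper bdd_above_infdist_ball) auto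
  finally show ?thesis .
qed

lemma bdd_below_SUP_infdist:
  fixes x :: "'a::euclidean_space"
  assumes "r > 0" "x \<in> N"
  shows "bdd_below ((\<lambda>L. SUP z \<in> N \<inter> ball x r. infdist z L / r) ` {L. is_line L})"
  using SUP_infdist_nonneg[OF assms] by (intro bdd_belowI2) auto

lemma beta_number_nonneg:
  fixes x :: "'a::euclidean_space"
  assumes "r > 0" "x \<in> N"
  shows "0 \<le> beta_number N x r"
  unfolding beta_number_def
  using SUP_infdist_nonneg[OF assms] ex_is_line by (intro cINF_greatest) auto

text \<open>The strict upper bound \<open>b\<close> makes an actual line available although the
  infimum may not be attained.\<close>

lemma beta_number_lessE:
  fixes x :: "'a::euclidean_space"
  assumes "r > 0" "x \<in> N" "beta_number N x r < b"
  obtains L where "is_line L" "\<And>z. z \<in> N \<inter> ball x r \<Longrightarrow> infdist z L < b * r"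
proof -
  obtain L where L: "is_line L" "(SUP z \<in> N \<inter> ball x r. infdist z L / r) < b"
    using assms ex_is_line bdd_below_SUP_infdist[OF assms(1,2)]
    unfolding beta_number_def by (subst (asm) cINF_less_iff) auto
  show thesis
  proof
    fix z assume z: "z \<in> N \<inter> ball x r"
    then have "infdist z L / r \<le> (SUP z \<in> N \<inter> ball x r. infdist z L / r)"
      using assms L by (intro cSUP_upper bdd_above_infdist_ball) auto
    then have "infdist z L / r < b" using L by linarith
    then show "infdist z L < b * r" using assms by (simp add: field_simps)
  qed fact
qed

text \<open>For a fixed line, the supremum of the distances, not divided by the radius, grows with
  the ball. This stands in for monotonicity of \<open>beta_number\<close> itself: it yields
  measurability in the radius and the comparison of nearby scales.\<close>

lemma beta_number_scaled_mono:
  fixes x :: "'a::euclidean_space"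
  assumes "0 < s" "s \<le> t" "x \<in> N"
  shows "s * beta_number N x s \<le> t * beta_number N x t"
proof -
  have "(s / t) * beta_number N x s \<le> beta_number N x t"
    unfolding beta_number_def[of N x t]
  proof (rule cINF_greatest)
    show "{L :: 'a set. is_line L} \<noteq> {}" using ex_is_line by auto
    fix L :: "'a set" assume "L \<in> {L. is_line L}"
    then have L: "is_line L" by simp
    have "beta_number N x s \<le> (SUP z \<in> N \<inter> ball x s. infdist z L / s)"
      unfolding beta_number_def using L assms
      by (intro cINF_lower bdd_below_SUP_infdist) auto
    also have "\<dots> \<le> (t / s) * (SUP z \<in> N \<inter> ball x t. infdist z L / t)"
    proof (rule cSUP_least)
      show "N \<inter> ball x s \<noteq> {}" using assms by auto
      fix z assume z: "z \<in> N \<inter> ball x s"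
      then have "infdist z L / t \<le> (SUP z \<in> N \<inter> ball x t. infdist z L / t)"
        using assms L by (intro cSUP_upper bdd_above_infdist_ball) auto
      then have "(t / s) * (infdist z L / t) \<le> (t / s) * (SUP z \<in> N \<inter> ball x t. infdist z L / t)"
        using assms by (intro mult_left_mono) auto
      then show "infdist z L / s \<le> (t / s) * (SUP z \<in> N \<inter> ball x t. infdist z L / t)"
        using assms by simp
    qed
    finally show "(s / t) * beta_number N x s \<le> (SUP z \<in> N \<inter> ball x t. infdist z L / t)"
      using assms by (simp add: field_simps)
  qed
  then show ?thesis using assms by (simp add: field_simps)
qed

text \<open>The integrand is \<open>\<phi>\<^sup>2 / t^3\<close> with \<open>\<phi>\<close>
  monotone, hence Borel; on \<open>{a..b}\<close> it is bounded by the numerator at \<open>b\<close>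
  over the denominator at \<open>a\<close>.\<close>

lemma set_integrable_beta_number:
  fixes x :: "'a::euclidean_space"
  assumes "0 < a" "x \<in> N"
  shows "set_integrable lborel {a..b} (\<lambda>t. (beta_number N x t)\<^sup>2 / t)"
proof -
  \<comment> \<open>Set to 0 for \<open>t \<le> 0\<close>, where \<open>beta_number\<close> has no
    meaning, so that \<open>\<phi>\<close> is monotone on the whole real line.\<close>
  define \<phi> where "\<phi> t = (if t > 0 then t * beta_number N x t else 0)" for t
  have \<phi>_nonneg: "0 \<le> \<phi> t" for t
    using beta_number_nonneg[of t x N] assms by (auto simp: \<phi>_def)
  have \<phi>_mono: "\<phi> s \<le> \<phi> t" if "s \<le> t" for s t
    using beta_number_scaled_mono[of s t x N] beta_number_nonneg[of t x N] assms that
    by (auto simp: \<phi>_def)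
  have [measurable]: "\<phi> \<in> borel_measurable borel"
    by (rule borel_measurable_mono) (simp add: mono_def \<phi>_mono)
  have "set_integrable lborel {a..b} (\<lambda>t. (\<phi> t)\<^sup>2 / t ^ 3)"
    unfolding set_integrable_def
  proof (rule integrableI_bounded_set_indicator[where B = "(\<phi> b)\<^sup>2 / a ^ 3"])
    have "norm ((\<phi> t)\<^sup>2 / t ^ 3) \<le> (\<phi> b)\<^sup>2 / a ^ 3" if "t \<in> {a..b}" for t
    proof -
      have "norm ((\<phi> t)\<^sup>2 / t ^ 3) = (\<phi> t)\<^sup>2 / t ^ 3" using that assms by simp
      also have "\<dots> \<le> (\<phi> b)\<^sup>2 / a ^ 3"
        using that assms \<phi>_nonneg[of t] \<phi>_mono[of t b]
        by (intro frac_le power_mono) auto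
      finally show ?thesis .
    qed
    then show "AE t in lborel. t \<in> {a..b} \<longrightarrow> norm ((\<phi> t)\<^sup>2 / t ^ 3) \<le> (\<phi> b)\<^sup>2 / a ^ 3"
      by blast
  qed (auto intro: emeasure_lborel_Icc_eq[THEN ord_eq_less_trans])
  moreover have "(\<phi> t)\<^sup>2 / t ^ 3 = (beta_number N x t)\<^sup>2 / t" if "t \<in> {a..b}" for t
    using that assms by (simp add: \<phi>_def field_simps power2_eq_square power3_eq_cube)
  ultimately show ?thesis
    by (subst (asm) set_integrable_cong) auto
qed

section \<open>Covering a ball by smaller balls\<close>

text \<open>Compactness of the unit ball, then scaling and translation. \<open>Q\<close> depends on
  the space only, so \<open>card Q\<close> can enter the final constant.\<close>

lemma ex_finite_half_balls:
  "\<exists>Q :: 'a::euclidean_space set. finite Q \<and>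
     (\<forall>a r. r > 0 \<longrightarrow> ball a r \<subseteq> (\<Union>q\<in>Q. ball (a + r *\<^sub>R q) (r / 2)))"
proof -
  obtain Q :: "'a set" where Q: "finite Q" "cball 0 1 \<subseteq> (\<Union>q\<in>Q. ball q (1/2))"
    using compact_cball[of "0::'a" 1] unfolding compact_eq_totally_bounded
    by (metis half_gt_zero zero_less_one)
  have "ball a r \<subseteq> (\<Union>q\<in>Q. ball (a + r *\<^sub>R q) (r / 2))" if "r > 0" for a :: 'a and r
  proof
    fix z assume z: "z \<in> ball a r"
    then have "(1 / r) *\<^sub>R (z - a) \<in> cball 0 1"
      using that by (simp add: dist_norm norm_minus_commute)
    then obtain q where q: "q \<in> Q" "(1 / r) *\<^sub>R (z - a) \<in> ball q (1/2)" using Q by blast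
    have "a + r *\<^sub>R q - z = r *\<^sub>R (q - (1 / r) *\<^sub>R (z - a))" using that by (simp add: algebra_simps)
    then have "norm (a + r *\<^sub>R q - z) = r * norm (q - (1 / r) *\<^sub>R (z - a))" using that by simp
    also have "\<dots> < r * (1/2)"
      using q that by (intro mult_strict_left_mono) (auto simp: dist_norm)
    finally show "z \<in> (\<Union>q\<in>Q. ball (a + r *\<^sub>R q) (r / 2))" using q by (auto simp: dist_norm)
  qed
  with Q show ?thesis by blast
qed

text \<open>
  By Pythagoras the excess over the radius \<open>r / 2\<close> is quadratic in the relative width \<open>h\<close>.
  The exact factor 2 in the number of balls is what makes the estimate iterable.
\<close>

lemma near_line_two_balls:
  fixes S :: "'a::euclidean_space set"
  assumes L: "is_line L" and r: "r > 0" and S: "S \<subseteq> ball a r"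
    and near: "\<And>z. z \<in> S \<Longrightarrow> infdist z L < h * r"
  obtains c1 c2 where "S \<subseteq> ball c1 (r / 2 * (1 + 2 * h\<^sup>2)) \<union> ball c2 (r / 2 * (1 + 2 * h\<^sup>2))"
proof -
  obtain q u where u: "norm u = 1" and q: "\<And>y. y \<in> L \<Longrightarrow> \<exists>t. y = q + t *\<^sub>R u"
    using is_line_direction[OF L] by blast
  have uu: "u \<bullet> u = 1" using u by (simp add: norm_eq_1)
  define \<rho> where "\<rho> = r / 2 * (1 + 2 * h\<^sup>2)"
  \<comment> \<open>In the direction \<open>u\<close>, \<open>S\<close> stays within
    \<open>r\<close> of the projection of \<open>a\<close>. The shifts used, \<open>r/2\<close> and
    \<open>-r/2\<close>, give the midpoints of the two halves of that segment.\<close>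
  define c where "c \<sigma> = q + ((a - q) \<bullet> u + \<sigma>) *\<^sub>R u" for \<sigma>
  have \<rho>: "\<rho> > 0" using r by (simp add: \<rho>_def add_pos_nonneg)
  have "z \<in> ball (c (r/2)) \<rho> \<union> ball (c (-r/2)) \<rho>" if z: "z \<in> S" for z
  proof -
    define t where "t = (z - a) \<bullet> u"
    define w where "w = z - q - ((z - q) \<bullet> u) *\<^sub>R u"
    have wu: "w \<bullet> u = 0" by (simp add: w_def uu inner_diff_left)
    have "L \<noteq> {}" using L by (auto simp: is_line_def)
    then have "\<exists>y\<in>L. dist z y < h * r"
      using near[OF z] by (subst (asm) infdist_def) (auto simp: cINF_less_iff)
    then obtain y where y: "y \<in> L" "dist z y < h * r" by blast
    obtain \<theta> where \<theta>: "y = q + \<theta> *\<^sub>R u" using q y by blast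
    have pyth: "(norm (w + \<kappa> *\<^sub>R u))\<^sup>2 = (norm w)\<^sup>2 + \<kappa>\<^sup>2" for \<kappa>
      unfolding power2_norm_eq_inner
      using wu uu by (simp add: inner_add_left inner_add_right inner_commute power2_eq_square)
    have zy: "z - y = w + ((z - q) \<bullet> u - \<theta>) *\<^sub>R u" by (simp add: w_def \<theta> algebra_simps)
    have "(norm w)\<^sup>2 \<le> (norm (z - y))\<^sup>2" unfolding zy pyth by simp
    also have "\<dots> < (h * r)\<^sup>2" using y by (intro power_strict_mono) (auto simp: dist_norm)
    finally have w: "(norm w)\<^sup>2 < h\<^sup>2 * r\<^sup>2" by (simp add: power_mult_distrib)
    have "\<bar>t\<bar> \<le> norm (z - a) * norm u" unfolding t_def by (rule Cauchy_Schwarz_ineq2)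
    also have "\<dots> < r" using S z u by (auto simp: dist_norm norm_minus_commute)
    finally have t: "\<bar>t\<bar> < r" .
    have zc: "z - c \<sigma> = w + (t - \<sigma>) *\<^sub>R u" for \<sigma>
      by (simp add: w_def t_def c_def algebra_simps)
    have "z \<in> ball (c \<sigma>) \<rho>" if \<sigma>: "\<bar>t - \<sigma>\<bar> \<le> r / 2" for \<sigma>
    proof -
      have "(t - \<sigma>)\<^sup>2 \<le> (r / 2)\<^sup>2" using \<sigma> r by (simp add: abs_le_square_iff[symmetric])
      with w have "(norm (z - c \<sigma>))\<^sup>2 < (r / 2)\<^sup>2 + h\<^sup>2 * r\<^sup>2"
        unfolding zc pyth by linarith
      also have "\<dots> \<le> \<rho>\<^sup>2"
      proof -
        \<comment> \<open>The factor \<open>1 + 2 * h\<^sup>2\<close> completes the square, leaving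
          a nonnegative surplus of order \<open>h^4\<close>.\<close>
        have "\<rho>\<^sup>2 = (r / 2)\<^sup>2 + h\<^sup>2 * r\<^sup>2 + (h\<^sup>2 * r)\<^sup>2"
          unfolding \<rho>_def by (simp add: power2_eq_square field_simps)
        then show ?thesis by simp
      qed
      finally have "norm (z - c \<sigma>) < \<rho>" using \<rho> by (simp add: power_less_imp_less_base)
      then show ?thesis by (simp add: dist_norm norm_minus_commute)
    qed
    moreover have "\<bar>t - r/2\<bar> \<le> r/2 \<or> \<bar>t - (-r/2)\<bar> \<le> r/2" using t by linarith
    ultimately show ?thesis by blast
  qed
  then show thesis using that \<rho>_def by blast
qed

text \<open>
  The number \<open>\<tau>\<close> does not depend on \<open>x\<close>: all \<open>x \<in> N\<close> in the ball share one subdivision of it.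
\<close>

lemma subdivide_ball:
  "\<exists>D>0. \<forall>(N :: 'a::euclidean_space set) a r \<epsilon>. r > 0 \<longrightarrow> \<epsilon> > 0 \<longrightarrow>
     (\<exists>P \<rho> \<tau>. finite P \<and> r / 2 \<le> \<rho> \<and> \<rho> \<le> 3 / 4 * r \<and> N \<inter> ball a r \<subseteq> (\<Union>p\<in>P. ball p \<rho>) \<and>
        0 \<le> \<tau> \<and> (\<forall>x \<in> N \<inter> ball a r. \<tau> \<le> beta_number N x (2 * r)) \<and>
        real (card P) * \<rho> \<le> r * exp (D * (\<tau>\<^sup>2 + \<epsilon>)))"
proof -
  obtain Q :: "'a set" where Q: "finite Q"
    "\<And>a r. r > 0 \<Longrightarrow> ball a r \<subseteq> (\<Union>q\<in>Q. ball (a + r *\<^sub>R q) (r / 2))"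
    using ex_finite_half_balls by blast
  \<comment> \<open>Product of the 8 in \<open>h2\<close> and of \<open>2 * (card Q + 1)\<close> in
    \<open>exp_ge\<close>, a factor large enough for both cases below.\<close>
  define D :: real where "D = 16 * (card Q + 1)"
  have "D > 0" by (simp add: D_def)
  have "\<exists>P \<rho> \<tau>. finite P \<and> r / 2 \<le> \<rho> \<and> \<rho> \<le> 3 / 4 * r \<and> N \<inter> ball a r \<subseteq> (\<Union>p\<in>P. ball p \<rho>) \<and>
        0 \<le> \<tau> \<and> (\<forall>x \<in> N \<inter> ball a r. \<tau> \<le> beta_number N x (2 * r)) \<and>
        real (card P) * \<rho> \<le> r * exp (D * (\<tau>\<^sup>2 + \<epsilon>))"
    if r: "r > 0" and \<epsilon>: "\<epsilon> > 0" for N :: "'a set" and a r \<epsilon>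
  proof (cases "N \<inter> ball a r = {}")
    case True
    then show ?thesis using r
      by (intro exI[of _ "{}"]) (rule exI[of _ "r / 2"], rule exI[of _ 0], simp)
  next
    case False
    define \<tau> where "\<tau> = (INF x \<in> N \<inter> ball a r. beta_number N x (2 * r))"
    have nonneg: "0 \<le> beta_number N x (2 * r)" if "x \<in> N \<inter> ball a r" for x
      using beta_number_nonneg[of "2 * r" x N] r that by auto
    have bdd: "bdd_below ((\<lambda>x. beta_number N x (2 * r)) ` (N \<inter> ball a r))"
      using nonneg by (intro bdd_belowI2[where m = 0]) auto
    have \<tau>0: "0 \<le> \<tau>" unfolding \<tau>_def using False nonneg by (intro cINF_greatest) auto
    have \<tau>_le: "\<forall>x \<in> N \<inter> ball a r. \<tau> \<le> beta_number N x (2 * r)"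
      unfolding \<tau>_def using bdd by (auto intro: cINF_lower)
    \<comment> \<open>With \<open>\<epsilon> = e\<^sup>2\<close>, the slack \<open>e\<close> added
      to \<open>\<tau>\<close> costs only
      \<open>(\<tau> + e)\<^sup>2 \<le> 2 * (\<tau>\<^sup>2 + \<epsilon>)\<close>.\<close>
    define e where "e = sqrt \<epsilon>"
    have e: "e > 0" "e\<^sup>2 = \<epsilon>" using \<epsilon> by (auto simp: e_def)
    define h where "h = 2 * (\<tau> + e)"
    have h0: "h > 0" using \<tau>0 e by (simp add: h_def)
    \<comment> \<open>The line of one near-minimiser \<open>x\<close> serves all of
      \<open>ball a r\<close>, because that ball lies in \<open>ball x (2 * r)\<close>; hence the
      radius \<open>2 * r\<close> in the statement.\<close>
    have "\<tau> < \<tau> + e" using e by simp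
    then obtain x where x: "x \<in> N \<inter> ball a r" "beta_number N x (2 * r) < \<tau> + e"
      unfolding \<tau>_def using cINF_less_iff[OF False bdd] by blast
    obtain L where L: "is_line L"
      "\<And>z. z \<in> N \<inter> ball x (2 * r) \<Longrightarrow> infdist z L < (\<tau> + e) * (2 * r)"
      using beta_number_lessE[of "2 * r" x N "\<tau> + e"] x r by auto
    have near: "infdist z L < h * r" if z: "z \<in> N \<inter> ball a r" for z
    proof -
      have "dist x z < 2 * r" using x z dist_triangle2[of x z a] by (auto simp: dist_commute)
      then show ?thesis using L(2)[of z] z by (simp add: h_def algebra_simps)
    qed
    have h2: "h\<^sup>2 \<le> 8 * (\<tau>\<^sup>2 + \<epsilon>)"
    proof -
      have "0 \<le> 4 * (\<tau> - e)\<^sup>2" by simp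
      also have "4 * (\<tau> - e)\<^sup>2 = 8 * (\<tau>\<^sup>2 + \<epsilon>) - h\<^sup>2"
        unfolding h_def e(2)[symmetric] by (simp add: power2_eq_square algebra_simps)
      finally show ?thesis by simp
    qed
    have exp_ge: "1 + 2 * (card Q + 1) * h\<^sup>2 \<le> exp (D * (\<tau>\<^sup>2 + \<epsilon>))"
    proof -
      have "2 * (card Q + 1) * h\<^sup>2 \<le> 2 * (card Q + 1) * (8 * (\<tau>\<^sup>2 + \<epsilon>))"
        using h2 by (intro mult_left_mono) auto
      also have "\<dots> = D * (\<tau>\<^sup>2 + \<epsilon>)" by (simp add: D_def algebra_simps)
      finally show ?thesis using exp_ge_add_one_self[of "D * (\<tau>\<^sup>2 + \<epsilon>)"] by linarith
    qed
    \<comment> \<open>Below the threshold \<open>1/2\<close> the enlarged radius is still at most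
      \<open>3/4 * r\<close>, so radii decay geometrically under iteration.\<close>
    show ?thesis
    proof (cases "h \<le> 1 / 2")
      case True
      define \<rho> where "\<rho> = r / 2 * (1 + 2 * h\<^sup>2)"
      obtain c1 c2 where c: "N \<inter> ball a r \<subseteq> ball c1 \<rho> \<union> ball c2 \<rho>"
        using near_line_two_balls[OF L(1) r _ near, of "N \<inter> ball a r" a] unfolding \<rho>_def by blast
      have "h\<^sup>2 \<le> (1/2)\<^sup>2" using True h0 by (intro power_mono) auto
      then have "r / 2 * (1 + 2 * h\<^sup>2) \<le> r / 2 * (3 / 2)"
        using r by (intro mult_left_mono) (auto simp: power2_eq_square)
      then have \<rho>1: "\<rho> \<le> 3 / 4 * r" by (simp add: \<rho>_def)
      have \<rho>2: "r / 2 \<le> \<rho>" using r by (simp add: \<rho>_def)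
      define P where "P = {c1, c2}"
      have P: "finite P" "N \<inter> ball a r \<subseteq> (\<Union>p\<in>P. ball p \<rho>)" using c by (auto simp: P_def)
      have "real (card P) * \<rho> \<le> 2 * \<rho>"
        using \<rho>2 r by (intro mult_right_mono) (auto simp: P_def card_insert_if)
      also have "\<dots> = r * (1 + 2 * h\<^sup>2)" by (simp add: \<rho>_def)
      also have "\<dots> \<le> r * exp (D * (\<tau>\<^sup>2 + \<epsilon>))"
      proof -
        have "1 + 2 * h\<^sup>2 \<le> 1 + 2 * (card Q + 1) * h\<^sup>2" by (simp add: algebra_simps)
        then show ?thesis using exp_ge r by (intro mult_left_mono) auto
      qed
      finally show ?thesis
        by (intro exI[of _ P]) (rule exI[of _ \<rho>], rule exI[of _ \<tau>], intro conjI P \<rho>1 \<rho>2 \<tau>0 \<tau>_le)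
    next
      case False
      \<comment> \<open>Here no line is used: \<open>h\<^sup>2 \<ge> 1/4\<close>, so the exponential
        alone outweighs \<open>card Q / 2\<close>.\<close>
      define P where "P = (\<lambda>q. a + r *\<^sub>R q) ` Q"
      have "(1/2)\<^sup>2 \<le> h\<^sup>2" using False by (intro power_mono) auto
      then have "2 * (card Q + 1) * (1/4) \<le> 2 * (card Q + 1) * h\<^sup>2"
        by (intro mult_left_mono) (auto simp: power2_eq_square)
      with exp_ge have le: "card Q / 2 \<le> exp (D * (\<tau>\<^sup>2 + \<epsilon>))" by (simp add: field_simps)
      have "card P * (r / 2) \<le> card Q * (r / 2)"
        using r Q(1) unfolding P_def by (intro mult_right_mono) (auto intro: card_image_le)
      also have "\<dots> = r * (card Q / 2)" by simp
      also have "\<dots> \<le> r * exp (D * (\<tau>\<^sup>2 + \<epsilon>))" using le r by (intro mult_left_mono) auto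
      finally have card: "card P * (r / 2) \<le> r * exp (D * (\<tau>\<^sup>2 + \<epsilon>))" .
      have P: "finite P" "N \<inter> ball a r \<subseteq> (\<Union>p\<in>P. ball p (r / 2))"
        using Q(1) Q(2)[OF r, of a] by (auto simp: P_def)
      have "r / 2 \<le> 3 / 4 * r" using r by simp
      with card show ?thesis
        by (intro exI[of _ P]) (rule exI[of _ "r / 2"], rule exI[of _ \<tau>],
            intro conjI order_refl P \<tau>0 \<tau>_le)
    qed
  qed
  with \<open>D > 0\<close> show ?thesis by blast
qed


section \<open>Iterating the subdivision down to a given scale\<close>

lemma integrable_beta_number:
  fixes x :: "'a::euclidean_space"
  assumes "0 < a" "x \<in> N"
  shows "(\<lambda>t. ((beta_number N x t)\<^sup>2 + \<epsilon>) / t) integrable_on {a..b}"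
proof -
  have "(\<lambda>t. (beta_number N x t)\<^sup>2 / t) integrable_on {a..b}"
    using set_borel_integral_eq_integral(1)[OF set_integrable_beta_number[OF assms]] .
  moreover have "(\<lambda>t. \<epsilon> / t) integrable_on {a..b}"
    using assms by (intro integrable_continuous_real continuous_intros) auto
  ultimately have "(\<lambda>t. (beta_number N x t)\<^sup>2 / t + \<epsilon> / t) integrable_on {a..b}"
    by (rule integrable_add)
  then show ?thesis by (simp add: add_divide_distrib)
qed

text \<open>On this window \<open>beta_number\<close> is at least \<open>3/4 * \<tau>\<close>, by
  the scaled monotonicity. The window ends at \<open>8/3 * r\<close> because a child ball has radius
  at most \<open>3/4 * r\<close>: its own window then ends at or before \<open>2 * r\<close>, where
  this one starts.\<close>

lemma integral_beta_number_ge: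
  fixes x :: "'a::euclidean_space" and r \<tau> \<epsilon> :: real
  assumes r: "0 < r" and x: "x \<in> N" and \<tau>: "0 \<le> \<tau>" "\<tau> \<le> beta_number N x (2 * r)" and \<epsilon>: "0 < \<epsilon>"
  shows "(\<tau>\<^sup>2 + \<epsilon>) / 8 \<le> integral {2 * r .. 8 / 3 * r} (\<lambda>t. ((beta_number N x t)\<^sup>2 + \<epsilon>) / t)"
proof -
  \<comment> \<open>Smallest numerator over largest denominator. The window has length
    \<open>2/3 * r\<close>, so integrating \<open>c\<close> divides the numerator by 4.\<close>
  define c where "c = (9 / 16 * \<tau>\<^sup>2 + \<epsilon>) / (8 / 3 * r)"
  have "c \<le> ((beta_number N x t)\<^sup>2 + \<epsilon>) / t" if t: "t \<in> {2 * r .. 8 / 3 * r}" for t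
  proof -
    have "2 * r * \<tau> \<le> 2 * r * beta_number N x (2 * r)" using r \<tau> by simp
    also have "\<dots> \<le> t * beta_number N x t" using t r x by (intro beta_number_scaled_mono) auto
    also have "\<dots> \<le> 8 / 3 * r * beta_number N x t"
      using t r x beta_number_nonneg[of t x N] by (intro mult_right_mono) auto
    finally have "3 / 4 * \<tau> \<le> beta_number N x t" using r by simp
    then have "(3 / 4 * \<tau>)\<^sup>2 \<le> (beta_number N x t)\<^sup>2" using \<tau> by (intro power_mono) auto
    then have "9 / 16 * \<tau>\<^sup>2 \<le> (beta_number N x t)\<^sup>2" by (simp add: power2_eq_square)
    then show ?thesis unfolding c_def using t r \<epsilon> by (intro frac_le) auto
  qed
  then have le: "integral {2 * r .. 8 / 3 * r} (\<lambda>_. c)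
      \<le> integral {2 * r .. 8 / 3 * r} (\<lambda>t. ((beta_number N x t)\<^sup>2 + \<epsilon>) / t)"
    using r x by (intro integral_le integrable_beta_number) auto
  have "(\<tau>\<^sup>2 + \<epsilon>) / 8 \<le> (9 / 16 * \<tau>\<^sup>2 + \<epsilon>) / 4" using \<epsilon> by (simp add: field_simps)
  also have "\<dots> = integral {2 * r .. 8 / 3 * r} (\<lambda>_. c)"
    using r by (simp add: c_def field_simps)
  finally show ?thesis using le by simp
qed

text \<open>\<open>M\<close> is a budget: each subdivision multiplies the sum of the radii by
  \<open>exp (D * (\<tau>\<^sup>2 + \<epsilon>))\<close>, paid for by the integral over that
  generation's window, and the windows do not overlap. The hypothesis \<open>s < 2 * r\<close>
  allows the last radius to fall below \<open>s\<close>, but not to \<open>s/2\<close>, which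
  explains the weight \<open>s / 2\<close>.\<close>

lemma covering_number_bound:
  "\<exists>D>0. \<forall>(N :: 'a::euclidean_space set) a r s \<epsilon> M. 0 < s \<longrightarrow> s < 2 * r \<longrightarrow> 0 < \<epsilon> \<longrightarrow>
     (\<exists>P. finite P \<and> card P * (s / 2) \<le> r * exp M \<and>
        {x \<in> N \<inter> ball a r.
           D * integral {2 * s .. 8 / 3 * r} (\<lambda>t. ((beta_number N x t)\<^sup>2 + \<epsilon>) / t) \<le> M}
          \<subseteq> (\<Union>p\<in>P. ball p s))"
proof -
  obtain D :: real where D: "D > 0"
    "\<And>(N :: 'a set) a r \<epsilon>. r > 0 \<Longrightarrow> \<epsilon> > 0 \<Longrightarrow>
     (\<exists>P \<rho> \<tau>. finite P \<and> r / 2 \<le> \<rho> \<and> \<rho> \<le> 3 / 4 * r \<and> N \<inter> ball a r \<subseteq> (\<Union>p\<in>P. ball p \<rho>) \<and>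
        0 \<le> \<tau> \<and> (\<forall>x \<in> N \<inter> ball a r. \<tau> \<le> beta_number N x (2 * r)) \<and>
        real (card P) * \<rho> \<le> r * exp (D * (\<tau>\<^sup>2 + \<epsilon>)))"
    using subdivide_ball by blast
  \<comment> \<open>\<open>m\<close> bounds the number of generations, as radii shrink by
    \<open>3/4\<close> or more each time. The factor 8 cancels the \<open>1/8\<close> in
    \<open>integral_beta_number_ge\<close>.\<close>
  have main: "\<exists>P. finite P \<and> card P * (s / 2) \<le> r * exp M \<and>
        {x \<in> N \<inter> ball a r.
           8 * D * integral {2 * s .. 8 / 3 * r} (\<lambda>t. ((beta_number N x t)\<^sup>2 + \<epsilon>) / t) \<le> M}
          \<subseteq> (\<Union>p\<in>P. ball p s)"
    if s: "0 < s" and "s < 2 * r" and \<epsilon>: "0 < \<epsilon>" and "r \<le> s * (4 / 3) ^ m"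
    for N :: "'a set" and a r s \<epsilon> M m
    using that(2,4)
  proof (induction m arbitrary: a r M)
    define J where "J x u v = integral {u..v} (\<lambda>t. ((beta_number N x t)\<^sup>2 + \<epsilon>) / t)" for x u v
    define E where "E a r M = {x \<in> N \<inter> ball a r. 8 * D * J x (2 * s) (8 / 3 * r) \<le> M}" for a r M
    have J_nonneg: "0 \<le> J x u v" if "0 < u" "x \<in> N" for x u v
      unfolding J_def using that \<epsilon> by (intro integral_nonneg integrable_beta_number) auto
    \<comment> \<open>At the final scale the ball with centre \<open>a\<close> and radius
      \<open>s\<close> suffices. It fits the bound only if \<open>M \<ge> 0\<close>, which any point
      of \<open>E a r M\<close> forces; otherwise the empty cover is used.\<close>
    have small: "\<exists>P. finite P \<and> card P * (s / 2) \<le> r * exp M \<and> E a r M \<subseteq> (\<Union>p\<in>P. ball p s)"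
      if r: "r \<le> s" "s < 2 * r" for a r M
    proof (cases "E a r M = {}")
      case True
      then show ?thesis using r s by (intro exI[of _ "{}"]) auto
    next
      case False
      then obtain x where x: "x \<in> E a r M" by blast
      then have "0 \<le> 8 * D * J x (2 * s) (8 / 3 * r)"
        using D s J_nonneg by (auto simp: E_def)
      with x have "0 \<le> M" by (auto simp: E_def)
      then have "r * 1 \<le> r * exp M" using r s by (intro mult_left_mono) auto
      then have "s / 2 \<le> r * exp M" using r by linarith
      then show ?thesis using r by (intro exI[of _ "{a}"]) (auto simp: E_def)
    qed
    {
      case 0
      then show ?case using small[where a = a and r = r and M = M] by (simp add: E_def J_def)
    next
      case (Suc m)
      show ?case
      proof (cases "r \<le> s")
        case True
        then show ?thesis using small[where a = a and r = r and M = M] Suc.prems by (simp add: E_def J_def)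
      next
        case False
        then have r: "s < r" "0 < r" using s by auto
        obtain P \<rho> \<tau> where P: "finite P" "N \<inter> ball a r \<subseteq> (\<Union>p\<in>P. ball p \<rho>)"
          and \<rho>: "r / 2 \<le> \<rho>" "\<rho> \<le> 3 / 4 * r"
          and \<tau>: "0 \<le> \<tau>" "\<And>x. x \<in> N \<inter> ball a r \<Longrightarrow> \<tau> \<le> beta_number N x (2 * r)"
          and card: "real (card P) * \<rho> \<le> r * exp (D * (\<tau>\<^sup>2 + \<epsilon>))"
          using D(2)[OF r(2) \<epsilon>, of N a] by blast
        \<comment> \<open>The budget left to the children. It is the same for all of them, since
          \<open>\<tau>\<close> belongs to the parent ball.\<close>
        define M' where "M' = M - D * (\<tau>\<^sup>2 + \<epsilon>)"
        have "\<exists>Q. finite Q \<and> card Q * (s / 2) \<le> \<rho> * exp M' \<and> E p \<rho> M' \<subseteq> (\<Union>q\<in>Q. ball q s)" for p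
          using Suc.IH[where r = \<rho> and a = p and M = M'] \<rho> r Suc.prems by (simp add: E_def J_def)
        then obtain Q where Q: "\<And>p. finite (Q p)" "\<And>p. card (Q p) * (s / 2) \<le> \<rho> * exp M'"
          "\<And>p. E p \<rho> M' \<subseteq> (\<Union>q\<in>Q p. ball q s)" by metis
        have "E a r M \<subseteq> (\<Union>q\<in>(\<Union>p\<in>P. Q p). ball q s)"
        proof
          fix x assume x: "x \<in> E a r M"
          then have xN: "x \<in> N" "x \<in> N \<inter> ball a r" by (auto simp: E_def)
          then obtain p where p: "p \<in> P" "x \<in> ball p \<rho>" using P by blast
          \<comment> \<open>Uses \<open>8/3 * \<rho> \<le> 2 * r\<close>: the integral for the child
            stops before the parent's window.\<close>
          have "J x (2 * s) (8 / 3 * \<rho>) \<le> J x (2 * s) (2 * r)"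
            unfolding J_def using s \<rho> \<epsilon> xN by (intro integral_subset_le integrable_beta_number) auto
          moreover have "J x (2 * s) (2 * r) + J x (2 * r) (8 / 3 * r) = J x (2 * s) (8 / 3 * r)"
            unfolding J_def using s r xN
            by (intro Henstock_Kurzweil_Integration.integral_combine integrable_beta_number) auto
          moreover have "(\<tau>\<^sup>2 + \<epsilon>) / 8 \<le> J x (2 * r) (8 / 3 * r)"
            unfolding J_def using integral_beta_number_ge r xN \<tau> \<epsilon> by blast
          ultimately have "J x (2 * s) (8 / 3 * \<rho>) + (\<tau>\<^sup>2 + \<epsilon>) / 8 \<le> J x (2 * s) (8 / 3 * r)"
            by linarith
          then have "8 * J x (2 * s) (8 / 3 * \<rho>) + (\<tau>\<^sup>2 + \<epsilon>) \<le> 8 * J x (2 * s) (8 / 3 * r)"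
            by argo
          then have "D * (8 * J x (2 * s) (8 / 3 * \<rho>) + (\<tau>\<^sup>2 + \<epsilon>)) \<le> D * (8 * J x (2 * s) (8 / 3 * r))"
            using D(1) by (intro mult_left_mono) auto
          also have "\<dots> = 8 * D * J x (2 * s) (8 / 3 * r)" by simp
          also have "\<dots> \<le> M" using x by (simp add: E_def)
          finally have "8 * D * J x (2 * s) (8 / 3 * \<rho>) \<le> M'"
            by (simp add: M'_def algebra_simps)
          then have "x \<in> E p \<rho> M'" using xN p by (simp add: E_def)
          then show "x \<in> (\<Union>q\<in>(\<Union>p\<in>P. Q p). ball q s)" using Q(3)[of p] p by blast
        qed
        moreover have "card (\<Union>p\<in>P. Q p) * (s / 2) \<le> r * exp M"
        proof -
          have "real (card (\<Union>p\<in>P. Q p)) \<le> (\<Sum>p\<in>P. real (card (Q p)))"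
            using card_UN_le[OF P(1), of Q] by (simp flip: of_nat_sum)
          then have "card (\<Union>p\<in>P. Q p) * (s / 2) \<le> (\<Sum>p\<in>P. real (card (Q p))) * (s / 2)"
            using s by (intro mult_right_mono) auto
          also have "\<dots> = (\<Sum>p\<in>P. card (Q p) * (s / 2))" by (simp add: sum_distrib_right)
          also have "\<dots> \<le> (\<Sum>p\<in>P. \<rho> * exp M')" using Q by (intro sum_mono) auto
          also have "\<dots> = real (card P) * \<rho> * exp M'" by simp
          also have "\<dots> \<le> r * exp (D * (\<tau>\<^sup>2 + \<epsilon>)) * exp M'" using card by (intro mult_right_mono) auto
          also have "\<dots> = r * exp M" by (simp add: M'_def flip: exp_add)
          finally show ?thesis .
        qed
        ultimately have "\<exists>P. finite P \<and> card P * (s / 2) \<le> r * exp M \<and> E a r M \<subseteq> (\<Union>p\<in>P. ball p s)"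
          using P Q by (intro exI[of _ "\<Union>p\<in>P. Q p"]) auto
        then show ?thesis by (simp add: E_def J_def)
      qed
    }
  qed
  show ?thesis
  proof (intro exI[of _ "8 * D"] conjI allI impI)
    fix N :: "'a set" and a :: 'a and r s \<epsilon> M :: real
    assume *: "0 < s" "s < 2 * r" "0 < \<epsilon>"
    obtain m where "r / s < (4 / 3) ^ m" using real_arch_pow[of "4 / 3" "r / s"] by auto
    then have "r \<le> s * (4 / 3) ^ m" using * by (simp add: field_simps)
    from main[OF * this] show "\<exists>P. finite P \<and> card P * (s / 2) \<le> r * exp M \<and>
        {x \<in> N \<inter> ball a r.
           8 * D * integral {2 * s .. 8 / 3 * r} (\<lambda>t. ((beta_number N x t)\<^sup>2 + \<epsilon>) / t) \<le> M}
          \<subseteq> (\<Union>p\<in>P. ball p s)" .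
  qed (use D in auto)
qed

section \<open>Hausdorff measure\<close>

lemma hausdorff_premeasure_mono:
  "A \<subseteq> B \<Longrightarrow> hausdorff_premeasure s \<delta> A \<le> hausdorff_premeasure s \<delta> B"
  unfolding hausdorff_premeasure_def by (intro INF_superset_mono) auto

text \<open>Take covers optimal up to \<open>e / 2^(n+1)\<close> and merge the double sequence into
  one along \<open>prod_decode\<close>; the diameter bound \<open>\<delta>\<close> is
  preserved.\<close>

lemma hausdorff_premeasure_UN_le:
  fixes E :: "nat \<Rightarrow> 'a::metric_space set"
  shows "hausdorff_premeasure s \<delta> (\<Union>n. E n) \<le> (\<Sum>n. hausdorff_premeasure s \<delta> (E n))"
proof (rule ennreal_le_epsilon)
  fix e :: real
  assume fin: "(\<Sum>n. hausdorff_premeasure s \<delta> (E n)) < top" and e: "0 < e"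
  define w where "w n = e * (1 / 2) ^ Suc n" for n
  have w: "0 < w n" for n using e by (simp add: w_def)
  have "\<exists>U. E n \<subseteq> (\<Union>i. U i) \<and> (\<forall>i. bounded (U i) \<and> diameter (U i) \<le> \<delta>) \<and>
      (\<Sum>i. hausdorff_gauge s (U i)) \<le> hausdorff_premeasure s \<delta> (E n) + ennreal (w n)" for n
  proof -
    \<comment> \<open>Finiteness is what makes adding \<open>w n\<close> a strict increase, so that
      a cover below it exists.\<close>
    have "hausdorff_premeasure s \<delta> (E n) \<noteq> top"
      using ennreal_suminf_lessD[OF fin, of n] by simp
    then have "hausdorff_premeasure s \<delta> (E n) < hausdorff_premeasure s \<delta> (E n) + ennreal (w n)"
      using w by (simp add: less_top)
    then show ?thesis
      unfolding hausdorff_premeasure_def[of s \<delta> "E n"] INF_less_iff by (auto intro: less_imp_le)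
  qed
  then obtain U where U: "\<And>n. E n \<subseteq> (\<Union>i. U n i)"
    "\<And>n i. bounded (U n i)" "\<And>n i. diameter (U n i) \<le> \<delta>"
    "\<And>n. (\<Sum>i. hausdorff_gauge s (U n i)) \<le> hausdorff_premeasure s \<delta> (E n) + ennreal (w n)"
    by metis
  define V where "V k = (case prod_decode k of (n, i) \<Rightarrow> U n i)" for k
  have "(\<Union>n. E n) \<subseteq> (\<Union>k. V k)"
  proof
    fix x assume "x \<in> (\<Union>n. E n)"
    then obtain n i where "x \<in> U n i" using U(1) by blast
    then have "x \<in> V (prod_encode (n, i))" by (simp add: V_def)
    then show "x \<in> (\<Union>k. V k)" by blast
  qed
  then have "hausdorff_premeasure s \<delta> (\<Union>n. E n) \<le> (\<Sum>k. hausdorff_gauge s (V k))"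
    unfolding hausdorff_premeasure_def using U(2,3)
    by (intro INF_lower) (auto simp: V_def split: prod.splits)
  also have "\<dots> = (\<Sum>k. (\<lambda>(n, i). hausdorff_gauge s (U n i)) (prod_decode k))"
    by (simp add: V_def case_prod_beta)
  also have "\<dots> = (\<Sum>n. \<Sum>i. hausdorff_gauge s (U n i))"
    by (intro suminf_ennreal_2dimen) auto
  also have "\<dots> \<le> (\<Sum>n. hausdorff_premeasure s \<delta> (E n) + ennreal (w n))"
    using U(4) by (intro suminf_le) auto
  also have "\<dots> = (\<Sum>n. hausdorff_premeasure s \<delta> (E n)) + (\<Sum>n. ennreal (w n))"
    by (intro suminf_add[symmetric]) auto
  also have "(\<Sum>n. ennreal (w n)) = ennreal e"
  proof -
    have "w sums (e * 1)" unfolding w_def by (intro sums_mult power_half_series)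
    then show ?thesis using w by (intro suminf_ennreal_eq) (auto intro: less_imp_le)
  qed
  finally show "hausdorff_premeasure s \<delta> (\<Union>n. E n)
      \<le> (\<Sum>n. hausdorff_premeasure s \<delta> (E n)) + ennreal e" .
qed

text \<open>The balls themselves, padded with empty sets, are an admissible cover; in a Euclidean
  space their diameter is exactly \<open>2 * \<rho>\<close>.\<close>

lemma hausdorff_premeasure_balls_le:
  fixes E :: "'a::euclidean_space set" and \<rho> :: real
  assumes "finite P" "E \<subseteq> (\<Union>p\<in>P. ball p \<rho>)" "0 < \<rho>" "2 * \<rho> \<le> \<delta>" "0 < s"
  shows "hausdorff_premeasure s \<delta> E \<le> ennreal (real (card P) * (2 * \<rho>) powr s)"
proof -
  obtain e where e: "bij_betw e {0..<card P} P" using ex_bij_betw_nat_finite[OF assms(1)] by blast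
  define U where "U i = (if i < card P then ball (e i) \<rho> else {})" for i
  have cov: "E \<subseteq> (\<Union>i. U i)"
  proof
    fix x assume "x \<in> E"
    then obtain p where p: "p \<in> P" "x \<in> ball p \<rho>" using assms by blast
    then obtain i where "i < card P" "p = e i"
      using bij_betw_imp_surj_on[OF e] by fastforce
    then have "x \<in> U i" using p by (simp add: U_def)
    then show "x \<in> (\<Union>i. U i)" by blast
  qed
  have "hausdorff_premeasure s \<delta> E \<le> (\<Sum>i. hausdorff_gauge s (U i))"
    unfolding hausdorff_premeasure_def using cov assms
    by (intro INF_lower) (auto simp: U_def)
  also have "\<dots> = (\<Sum>i<card P. hausdorff_gauge s (U i))"
    by (intro suminf_finite) (auto simp: U_def hausdorff_gauge_def)
  also have "\<dots> = (\<Sum>i<card P. ennreal ((2 * \<rho>) powr s))"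
    using assms by (intro sum.cong) (auto simp: U_def hausdorff_gauge_def)
  also have "\<dots> = ennreal (real (card P) * (2 * \<rho>) powr s)"
    by (simp add: ennreal_mult ennreal_of_nat_eq_real_of_nat)
  finally show ?thesis .
qed

lemma hausdorff_measure_eq_0_iff:
  "hausdorff_measure s A = 0 \<longleftrightarrow> (\<forall>\<delta>>0. hausdorff_premeasure s \<delta> A = 0)"
  unfolding hausdorff_measure_def by (auto simp flip: bot_ennreal)

lemma hausdorff_measure_UN_eq_0:
  fixes E :: "nat \<Rightarrow> 'a::metric_space set"
  assumes "\<And>n. hausdorff_measure s (E n) = 0"
  shows "hausdorff_measure s (\<Union>n. E n) = 0"
  unfolding hausdorff_measure_eq_0_iff
proof (intro allI impI)
  fix \<delta> :: real assume "\<delta> > 0"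
  then show "hausdorff_premeasure s \<delta> (\<Union>n. E n) = 0"
    using hausdorff_premeasure_UN_le[of s \<delta> E] assms by (simp add: hausdorff_measure_eq_0_iff)
qed

text \<open>The convergence half of Borel-Cantelli: \<open>A\<close> lies in every tail union, tails
  of the summable cost are arbitrarily small, and \<open>\<rho> \<longlonglongrightarrow> 0\<close>
  makes late balls admissible for any \<open>\<delta>\<close>.\<close>

lemma hausdorff_measure_limsup_eq_0:
  fixes E :: "nat \<Rightarrow> 'a::euclidean_space set"
  assumes s: "0 < s" and \<rho>: "\<And>k. 0 < \<rho> k" "\<rho> \<longlonglongrightarrow> 0"
    and P: "\<And>k. finite (P k)" "\<And>k. E k \<subseteq> (\<Union>p\<in>P k. ball p (\<rho> k))"
    and sum: "summable (\<lambda>k. card (P k) * (2 * \<rho> k) powr s)"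
    and A: "\<And>x m. x \<in> A \<Longrightarrow> \<exists>k\<ge>m. x \<in> E k"
  shows "hausdorff_measure s A = 0"
  unfolding hausdorff_measure_eq_0_iff
proof (intro allI impI)
  fix \<delta> :: real assume \<delta>: "\<delta> > 0"
  define f where "f k = card (P k) * (2 * \<rho> k) powr s" for k
  have f0: "0 \<le> f k" for k by (simp add: f_def)
  have "hausdorff_premeasure s \<delta> A \<le> 0"
  proof (rule ennreal_le_epsilon)
    fix e :: real assume e: "0 < e"
    obtain m1 where m1: "\<And>n. n \<ge> m1 \<Longrightarrow> norm (\<Sum>i. f (i + n)) < e"
      using suminf_exist_split[OF e sum] unfolding f_def by blast
    have "eventually (\<lambda>k. \<rho> k < \<delta> / 2) sequentially"
      using \<rho>(2) \<delta> by (intro order_tendstoD) auto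
    then obtain m2 where m2: "\<And>n. n \<ge> m2 \<Longrightarrow> \<rho> n < \<delta> / 2"
      by (auto simp: eventually_sequentially)
    define m where "m = max m1 m2"
    have "A \<subseteq> (\<Union>i. E (i + m))"
    proof
      fix x assume "x \<in> A"
      then obtain k where k: "k \<ge> m" "x \<in> E k" using A by blast
      then have "x \<in> E (k - m + m)" by simp
      then show "x \<in> (\<Union>i. E (i + m))" by blast
    qed
    then have "hausdorff_premeasure s \<delta> A \<le> hausdorff_premeasure s \<delta> (\<Union>i. E (i + m))"
      by (rule hausdorff_premeasure_mono)
    also have "\<dots> \<le> (\<Sum>i. hausdorff_premeasure s \<delta> (E (i + m)))"
      by (rule hausdorff_premeasure_UN_le)
    also have "\<dots> \<le> (\<Sum>i. ennreal (f (i + m)))"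
    proof (intro suminf_le)
      fix i
      have "2 * \<rho> (i + m) \<le> \<delta>" using m2[of "i + m"] unfolding m_def by linarith
      then show "hausdorff_premeasure s \<delta> (E (i + m)) \<le> ennreal (f (i + m))"
        unfolding f_def using P \<rho> s by (intro hausdorff_premeasure_balls_le) auto
    qed auto
    also have "\<dots> = ennreal (\<Sum>i. f (i + m))"
      using sum f0 by (intro suminf_ennreal2) (auto simp: f_def intro: summable_ignore_initial_segment)
    also have "\<dots> \<le> ennreal e"
      using m1[of m] by (intro ennreal_leI) (auto simp: m_def)
    finally show "hausdorff_premeasure s \<delta> A \<le> 0 + ennreal e" by simp
  qed
  then show "hausdorff_premeasure s \<delta> A = 0" by simp
qed

lemma hausdorff_dim_le:
  assumes "0 \<le> s" "hausdorff_measure s A = 0"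
  shows "hausdorff_dim A \<le> ennreal s"
  unfolding hausdorff_dim_def using assms by (intro INF_lower) auto

section \<open>The dimension bound\<close>

text \<open>The lower limit gives real scales \<open>t\<close>, whereas Borel-Cantelli needs a
  sequence of scales.\<close>

lemma ex_dyadic_scale:
  fixes t :: real
  assumes "0 < t" "t < 1"
  obtains k where "(1 / 2) ^ Suc k \<le> t" "t \<le> (1 / 2) ^ k"
proof -
  define k where "k = (LEAST k. (1 / 2) ^ Suc k \<le> t)"
  obtain n where "(1 / 2) ^ n < t" using real_arch_pow_inv[of t "1/2"] assms by auto
  moreover have "(1 / 2) ^ Suc n \<le> (1 / 2 :: real) ^ n" by simp
  ultimately have "(1 / 2) ^ Suc n \<le> t" by linarith
  then have k: "(1 / 2) ^ Suc k \<le> t" unfolding k_def by (rule LeastI)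
  have "t \<le> (1 / 2) ^ k"
  proof (cases k)
    case (Suc j)
    then have "\<not> (1 / 2) ^ Suc j \<le> t" 
      using not_less_Least[of j "\<lambda>k. (1 / 2) ^ Suc k \<le> t"] by (simp add: k_def)
    then show ?thesis using Suc by simp
  qed (use assms in simp)
  with k show thesis by (rule that)
qed

lemma integral_inverse_to_1:
  fixes a :: real
  assumes "0 < a" "a \<le> 1"
  shows "integral {a..1} (\<lambda>t. \<epsilon> / t) = \<epsilon> * (- ln a)"
proof -
  have "((\<lambda>t. \<epsilon> / t) has_integral (\<epsilon> * ln 1 - \<epsilon> * ln a)) {a..1}"
    using assms
    by (intro fundamental_theorem_of_calculus)
      (auto simp flip: has_real_derivative_iff_has_vector_derivative intro!: derivative_eq_intros)
  then show ?thesis by (simp add: integral_unique)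
qed

text \<open>Rounding a good scale \<open>t\<close> up to \<open>(1/2)^k\<close> only shortens the
  integral, while \<open>- ln t \<le> Suc k * ln 2\<close>. One \<open>\<epsilon>\<close> comes from
  the lower limit, the other from integrating \<open>\<epsilon> / t\<close>.\<close>

lemma frequently_small_beta_integral:
  fixes x :: "'a::euclidean_space"
  assumes x: "x \<in> N" and \<epsilon>: "0 < \<epsilon>" and \<kappa>: "0 \<le> \<kappa>"
    and lim: "Liminf (at_right 0)
          (\<lambda>r::real. ereal ((LBINT t:{r..1}. (beta_number N x t)\<^sup>2 / t) / (- ln r))) \<le> ereal \<kappa>"
  shows "\<exists>k\<ge>m. integral {(1 / 2) ^ k .. 1} (\<lambda>t. ((beta_number N x t)\<^sup>2 + \<epsilon>) / t)
    \<le> (\<kappa> + 2 * \<epsilon>) * (Suc k * ln 2)"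
proof -
  define I where "I r = integral {r..1} (\<lambda>t. (beta_number N x t)\<^sup>2 / t)" for r
  have int: "(\<lambda>t. (beta_number N x t)\<^sup>2 / t) integrable_on {r..1}" if "0 < r" for r
    using integrable_beta_number[OF that x, of 0] by simp
  have int': "(\<lambda>t. \<epsilon> / t) integrable_on {r..1}" if "0 < r" for r
    using that by (intro integrable_continuous_real continuous_intros) auto
  have I_eq: "(LBINT t:{r..1}. (beta_number N x t)\<^sup>2 / t) = I r" if "0 < r" for r
    unfolding I_def
    using set_borel_integral_eq_integral(2)[OF set_integrable_beta_number[OF that x]] .
  \<comment> \<open>The bound \<open>(1/2)^Suc m\<close> on \<open>t\<close> is what forces
    \<open>k \<ge> m\<close> later.\<close>
  have "\<exists>t. 0 < t \<and> t < (1 / 2) ^ Suc m \<and> I t / (- ln t) < \<kappa> + \<epsilon>"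
  proof (rule ccontr)
    assume "\<not> ?thesis"
    then have *: "\<kappa> + \<epsilon> \<le> I t / (- ln t)" if "0 < t" "t < (1 / 2) ^ Suc m" for t
      using that by (meson not_less)
    have "eventually (\<lambda>t::real. t \<in> {0<..<(1 / 2) ^ Suc m}) (at_right 0)"
      by (rule eventually_at_right_real) simp
    then have "eventually (\<lambda>t::real. ereal (\<kappa> + \<epsilon>) \<le>
        ereal ((LBINT t:{t..1}. (beta_number N x t)\<^sup>2 / t) / (- ln t))) (at_right 0)"
      by eventually_elim (use * I_eq in auto)
    then have "ereal (\<kappa> + \<epsilon>) \<le> ereal \<kappa>" by (rule order_trans[OF Liminf_bounded lim])
    then show False using \<epsilon> by simp
  qed
  then obtain t where t: "0 < t" "t < (1 / 2) ^ Suc m" "I t / (- ln t) < \<kappa> + \<epsilon>" by blast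
  have "(1 / 2 :: real) ^ Suc m \<le> 1" by (intro power_le_one) auto
  then have t1: "t < 1" using t by linarith
  obtain k where k: "(1 / 2) ^ Suc k \<le> t" "t \<le> (1 / 2) ^ k" using ex_dyadic_scale[OF t(1) t1] .
  have "(1 / 2 :: real) ^ Suc k < (1 / 2) ^ Suc m" using k t by linarith
  then have "m \<le> k" by (subst (asm) power_strict_decreasing_iff) auto
  have "ln ((1 / 2) ^ Suc k) \<le> ln t" using k t by (subst ln_le_cancel_iff) auto
  then have ln_t: "- ln t \<le> Suc k * ln 2" by (simp add: ln_realpow ln_div algebra_simps)
  have half: "0 < (1 / 2 :: real) ^ k" "(1 / 2 :: real) ^ k \<le> 1" by (auto intro: power_le_one)
  have "I ((1 / 2) ^ k) \<le> I t"
    unfolding I_def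
    by (intro integral_subset_le int half t(1)) (use k(2) t(1) in auto)
  also have "\<dots> \<le> (\<kappa> + \<epsilon>) * (- ln t)" using t t1 by (simp add: field_simps)
  also have "\<dots> \<le> (\<kappa> + \<epsilon>) * (Suc k * ln 2)" using ln_t \<kappa> \<epsilon> by (intro mult_left_mono) auto
  finally have 1: "I ((1 / 2) ^ k) \<le> (\<kappa> + \<epsilon>) * (Suc k * ln 2)" .
  have "integral {(1 / 2) ^ k .. 1} (\<lambda>t. \<epsilon> / t) = \<epsilon> * (k * ln 2)"
    using half by (subst integral_inverse_to_1) (auto simp: ln_realpow ln_div)
  also have "\<dots> \<le> \<epsilon> * (Suc k * ln 2)" using \<epsilon> by (intro mult_left_mono mult_right_mono) auto
  finally have 2: "integral {(1 / 2) ^ k .. 1} (\<lambda>t. \<epsilon> / t) \<le> \<epsilon> * (Suc k * ln 2)" .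
  have "integral {(1 / 2) ^ k .. 1} (\<lambda>t. ((beta_number N x t)\<^sup>2 + \<epsilon>) / t)
      = I ((1 / 2) ^ k) + integral {(1 / 2) ^ k .. 1} (\<lambda>t. \<epsilon> / t)"
    unfolding I_def add_divide_distrib
    by (intro Henstock_Kurzweil_Integration.integral_add int int' half)
  also have "\<dots> \<le> (\<kappa> + 2 * \<epsilon>) * (Suc k * ln 2)" using 1 2 by (simp add: algebra_simps)
  finally show ?thesis using \<open>m \<le> k\<close> by blast
qed

text \<open>At scale \<open>\<rho> k\<close> about \<open>\<rho> k powr (- 1 - b)\<close> balls
  suffice, with \<open>b\<close> close to \<open>D * \<kappa>\<close>, so the cost in any dimension
  above \<open>1 + b\<close> is summable.\<close>

lemma hausdorff_dim_le_of_beta_numbers: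
  "\<exists>D>0. \<forall>(N :: 'a::euclidean_space set) \<kappa>. 0 \<le> \<kappa> \<longrightarrow>
     (\<forall>x\<in>N. Liminf (at_right 0)
          (\<lambda>r::real. ereal ((LBINT t:{r..1}. (beta_number N x t)\<^sup>2 / t) / (- ln r))) \<le> ereal \<kappa>)
      \<longrightarrow> hausdorff_dim N \<le> ennreal (1 + D * \<kappa>)"
proof -
  obtain D :: real where D: "D > 0"
    "\<And>(N :: 'a set) a r s \<epsilon> M. 0 < s \<Longrightarrow> s < 2 * r \<Longrightarrow> 0 < \<epsilon> \<Longrightarrow>
     (\<exists>P. finite P \<and> card P * (s / 2) \<le> r * exp M \<and>
        {x \<in> N \<inter> ball a r.
           D * integral {2 * s .. 8 / 3 * r} (\<lambda>t. ((beta_number N x t)\<^sup>2 + \<epsilon>) / t) \<le> M}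
          \<subseteq> (\<Union>p\<in>P. ball p s))"
    using covering_number_bound by blast
  have "hausdorff_dim N \<le> ennreal (1 + D * \<kappa>)"
    if \<kappa>: "0 \<le> \<kappa>" and lim: "\<And>x. x \<in> N \<Longrightarrow> Liminf (at_right 0)
          (\<lambda>r::real. ereal ((LBINT t:{r..1}. (beta_number N x t)\<^sup>2 / t) / (- ln r))) \<le> ereal \<kappa>"
    for N :: "'a set" and \<kappa>
  proof (rule ennreal_le_epsilon)
    fix e :: real assume e: "0 < e"
    \<comment> \<open>Then \<open>2 * D * \<epsilon> = e / 2\<close>: half of \<open>e\<close> is
      spent on \<open>\<epsilon>\<close>, half remains for convergence.\<close>
    define \<epsilon> where "\<epsilon> = e / (4 * D)"
    have \<epsilon>: "0 < \<epsilon>" using e D by (simp add: \<epsilon>_def)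
    define p where "p = 1 + D * \<kappa> + e"
    have p: "1 < p" using e \<kappa> D by (simp add: p_def add_nonneg_pos)
    define b where "b = D * (\<kappa> + 2 * \<epsilon>)"
    have pb: "p - 1 - b = e / 2" using D by (simp add: p_def b_def \<epsilon>_def field_simps)
    \<comment> \<open>The shift \<open>Suc k\<close> makes \<open>2 * \<rho> k = (1/2)^k\<close>,
      the lower limit in \<open>frequently_small_beta_integral\<close>.\<close>
    define \<rho> :: "nat \<Rightarrow> real" where "\<rho> k = (1 / 2) ^ Suc k" for k
    have \<rho>0: "0 < \<rho> k" for k by (simp add: \<rho>_def)
    have \<rho>_half: "\<rho> k \<le> 1 / 2" for k
      using power_le_one[of "1/2 :: real" k] by (simp add: \<rho>_def)
    have \<rho>_powr: "\<rho> k powr \<theta> = ((1 / 2) powr \<theta>) ^ Suc k" for k \<theta>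
      unfolding \<rho>_def powr_def
      by (simp add: ln_realpow algebra_simps flip: exp_of_nat_mult del: power_Suc)
    \<comment> \<open>The radius \<open>3/8\<close> turns the upper limit \<open>8/3 * r\<close> of
      \<open>covering_number_bound\<close> into 1.\<close>
    have null: "hausdorff_measure p (N \<inter> ball a (3 / 8)) = 0" for a
    proof -
      define E where "E k = {x \<in> N \<inter> ball a (3 / 8). D * integral {2 * \<rho> k .. 8 / 3 * (3 / 8)}
          (\<lambda>t. ((beta_number N x t)\<^sup>2 + \<epsilon>) / t) \<le> b * (Suc k * ln 2)}" for k
      have "\<exists>P. finite P \<and> card P * (\<rho> k / 2) \<le> 3 / 8 * exp (b * (Suc k * ln 2)) \<and>
          E k \<subseteq> (\<Union>p\<in>P. ball p (\<rho> k))" for k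
        unfolding E_def by (rule D(2)) (use \<rho>0[of k] \<rho>_half[of k] \<epsilon> in auto)
      then obtain P where P: "\<And>k. finite (P k)" "\<And>k. E k \<subseteq> (\<Union>p\<in>P k. ball p (\<rho> k))"
        "\<And>k. card (P k) * (\<rho> k / 2) \<le> 3 / 8 * exp (b * (Suc k * ln 2))" by metis
      define q :: real where "q = (1 / 2) powr (e / 2)"
      have q: "0 < q" "q < 1" using e powr_less_mono'[of "1/2" 0 "e/2"] by (auto simp: q_def)
      have bound: "card (P k) * (2 * \<rho> k) powr p \<le> 3 / 4 * 2 powr p * q ^ Suc k" for k
      proof -
        have "exp (b * (Suc k * ln 2)) = \<rho> k powr (- b)"
          using \<rho>0[of k] by (simp add: powr_def \<rho>_def ln_realpow ln_mult ln_div algebra_simps)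
        then have "card (P k) * \<rho> k \<le> 3 / 4 * \<rho> k powr (- b)" using P(3)[of k] by (simp add: mult_ac)
        \<comment> \<open>One power of \<open>\<rho> k\<close> offsets the count; the other
          \<open>p - 1\<close> beat the loss \<open>- b\<close> by the exponent
          \<open>e / 2\<close>.\<close>
        then have "(card (P k) * \<rho> k) * (2 powr p * \<rho> k powr (p - 1))
            \<le> (3 / 4 * \<rho> k powr (- b)) * (2 powr p * \<rho> k powr (p - 1))"
          by (intro mult_right_mono) auto
        also have "\<dots> = 3 / 4 * 2 powr p * (\<rho> k powr (- b) * \<rho> k powr (p - 1))" by simp
        also have "\<rho> k powr (- b) * \<rho> k powr (p - 1) = \<rho> k powr (e / 2)"
          unfolding powr_add[symmetric] pb[symmetric] by simp
        also have "\<dots> = q ^ Suc k" unfolding q_def by (rule \<rho>_powr)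
        also have "(card (P k) * \<rho> k) * (2 powr p * \<rho> k powr (p - 1)) = card (P k) * (2 * \<rho> k) powr p"
        proof -
          have "\<rho> k powr p = \<rho> k * \<rho> k powr (p - 1)"
            using powr_add[of "\<rho> k" 1 "p - 1"] \<rho>0[of k] by simp
          then show ?thesis using \<rho>0[of k] by (simp add: powr_mult)
        qed
        finally show ?thesis .
      qed
      show ?thesis
      proof (rule hausdorff_measure_limsup_eq_0[of p \<rho> P E])
        show "0 < p" using p by simp
        show "\<rho> \<longlonglongrightarrow> 0"
          unfolding \<rho>_def by (intro LIMSEQ_Suc LIMSEQ_power_zero) simp
        have "summable (\<lambda>k. 3 / 4 * 2 powr p * (q * q ^ k))"
          using q by (intro summable_mult summable_geometric) auto
        then show "summable (\<lambda>k. card (P k) * (2 * \<rho> k) powr p)"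
          by (rule summable_comparison_test') (use bound in auto)
        fix x m assume x: "x \<in> N \<inter> ball a (3 / 8)"
        then obtain k where k: "k \<ge> m"
          "integral {(1 / 2) ^ k .. 1} (\<lambda>t. ((beta_number N x t)\<^sup>2 + \<epsilon>) / t)
             \<le> (\<kappa> + 2 * \<epsilon>) * (Suc k * ln 2)"
          using frequently_small_beta_integral[of x N \<epsilon> \<kappa> m] \<epsilon> \<kappa> lim by blast
        have "D * integral {(1 / 2) ^ k .. 1} (\<lambda>t. ((beta_number N x t)\<^sup>2 + \<epsilon>) / t)
            \<le> b * (Suc k * ln 2)"
          using mult_left_mono[OF k(2), of D] D by (simp add: b_def algebra_simps)
        then have "x \<in> E k" using x by (simp add: E_def \<rho>_def)
        with k show "\<exists>k\<ge>m. x \<in> E k" by blast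
      qed (use \<rho>0 P in auto)
    qed
    \<comment> \<open>Separability passes from balls of radius \<open>3/8\<close> to all of
      \<open>N\<close>, which may be unbounded.\<close>
    obtain X :: "'a set" where X: "countable X" "\<And>U. open U \<Longrightarrow> U \<noteq> {} \<Longrightarrow> \<exists>d\<in>X. d \<in> U"
      using countable_dense_setE by blast
    have "X \<noteq> {}" using X(2)[of UNIV] by auto
    have "N = (\<Union>n. N \<inter> ball (from_nat_into X n) (3 / 8))"
    proof -
      have "x \<in> (\<Union>n. ball (from_nat_into X n) (3 / 8))" for x
      proof -
        obtain d where d: "d \<in> X" "d \<in> ball x (3 / 8)" using X(2)[of "ball x (3 / 8)"] by auto
        obtain n where "from_nat_into X n = d"
          using from_nat_into_surj[OF X(1) d(1)] by blast
        then show ?thesis using d by (auto simp: dist_commute)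
      qed
      then show ?thesis by blast
    qed
    then have "hausdorff_measure p N = 0" using hausdorff_measure_UN_eq_0[OF null] by metis
    then have "hausdorff_dim N \<le> ennreal p" using p by (intro hausdorff_dim_le) auto
    also have "\<dots> = ennreal (1 + D * \<kappa>) + ennreal e"
      using e \<kappa> D by (simp add: p_def flip: ennreal_plus)
    finally show "hausdorff_dim N \<le> ennreal (1 + D * \<kappa>) + ennreal e" .
  qed
  with D(1) show ?thesis by blast
qed

theorem theorem2:
  assumes "CARD('n::finite) \<ge> 2"
  shows "\<exists>c::real. c > 0 \<and>
    (\<forall>(N :: (real ^ 'n) set) (\<beta>\<^sub>0 :: real).
      (\<forall>x\<in>N. Liminf (at_right 0)
          (\<lambda>r::real. ereal ((LBINT t:{r..1}. (beta_number N x t)\<^sup>2 / t) / (- ln r)))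
        \<le> ereal (\<beta>\<^sub>0\<^sup>2))
      \<longrightarrow> hausdorff_dim N \<le> ennreal (1 + c * \<beta>\<^sub>0\<^sup>2))"
proof -
  obtain D :: real where "D > 0" and D: "\<And>(N :: (real ^ 'n) set) \<kappa>. 0 \<le> \<kappa> \<Longrightarrow>
     (\<forall>x\<in>N. Liminf (at_right 0)
          (\<lambda>r::real. ereal ((LBINT t:{r..1}. (beta_number N x t)\<^sup>2 / t) / (- ln r))) \<le> ereal \<kappa>)
      \<Longrightarrow> hausdorff_dim N \<le> ennreal (1 + D * \<kappa>)"
    using hausdorff_dim_le_of_beta_numbers by blast
  show ?thesis using \<open>D > 0\<close> D[OF zero_le_power2] by blast
qed

end
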